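(* Let $(X,\leq)$ be a compact partially ordered space, let $\mathrm{H}_+(X)$ be the group of all order-preserving homeomorphisms of $X$, equipped with the compact-open topology $\tau_{co}$, and let $P$ be a closed subgroup of $\mathrm{H}_+(X)$. Then the compact-open topology $\tau_{co}$ on $P$ is minimal within the class of $\pi$-uniform topologies on $P$.
   Context: A compact partially ordered space is a compact topological space $X$ equipped with a partial order $\leq$ (reflexive, antisymmetric, transitive) whose graph $\{(x,y): x\leq y\}$ is closed in $X\times X$. All topological spaces are assumed Hausdorff. A compact space carries its unique compatible uniformity $\mathcal U$. The group $\mathrm{H}(X)$ of all homeomorphisms of $X$, and each of its subgroups, is given the compact-open topology $\tau_{co}$, which for compact $X$ is the topology of uniform convergence; "closed" refers to this topology. Let $P$ be a subgroup of $\mathrm{H}(X)$. A Hausdorff group topology $\tau$ on $P$ is called $\pi$-uniform if the natural action $\pi: P\times X\to X$, $(g,x)\mapsto gx$, satisfies: for every $g_0\in P$ and every entourage $\varepsilon\in\mathcal U$ there exist $\delta\in\mathcal U$ and a $\tau$-neighborhood $U$ of $g_0$ such that $(gx,gy)\in\varepsilon$ for all $(x,y)\in\delta$ and all $g\in U$. A topology is minimal within a class of topologies if it belongs to the class and no strictly coarser topology belongs to the class. *)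

theory Defs
  imports "HOL-Analysis.Analysis" "HOL-Algebra.Group"
begin

definition closed_order :: "'a::{topological_space,order} itself \<Rightarrow> bool" where
  "closed_order _ \<longleftrightarrow> closed {(x::'a, y). x \<le> y}"

definition homeo_group :: "('a::topological_space \<Rightarrow> 'a) monoid" where
  "homeo_group = \<lparr>carrier = {f. homeomorphic_map euclidean euclidean f}, mult = (\<circ>), one = id\<rparr>"

(* Order-preservation is required in both directions: for a bare monotone homeomorphism
   the inverse need not be monotone, so those form only a monoid in general. *)
definition homeo_plus_group :: "('a::{topological_space,order} \<Rightarrow> 'a) monoid" where
  "homeo_plus_group =
     homeo_group\<lparr>carrier := {f \<in> carrier homeo_group. \<forall>x y. x \<le> y \<longleftrightarrow> f x \<le> f y}\<rparr>"

text \<open>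
  The compact-open topology on a set \<open>P\<close> of self-maps, generated by the sets of maps in \<open>P\<close>
  sending a compact \<open>K\<close> into an open \<open>V\<close>. The case \<open>K = {}\<close> makes \<open>P\<close> the whole space.
\<close>
definition compact_open_topology ::
    "('a::topological_space \<Rightarrow> 'a) set \<Rightarrow> ('a \<Rightarrow> 'a) topology" where
  "compact_open_topology P =
     topology_generated_by {{f \<in> P. f ` K \<subseteq> V} |K V. compact K \<and> open V}"

definition group_topology :: "('g, 'm) monoid_scheme \<Rightarrow> 'g topology \<Rightarrow> bool" where
  "group_topology G T \<longleftrightarrow>
     topspace T = carrier G \<and>
     continuous_map (prod_topology T T) T (\<lambda>(x, y). x \<otimes>\<^bsub>G\<^esub> y) \<and>
     continuous_map T T (m_inv G)"

text \<open>
  Entourages are the predicates holding eventually in the filter \<open>uniformity\<close>. On a compact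
  Hausdorff space the uniformity given by the class \<open>uniform_space\<close>, being compatible with the
  topology, is the unique such one.
\<close>
definition pi_uniform :: "('a::uniform_space \<Rightarrow> 'a) set \<Rightarrow> ('a \<Rightarrow> 'a) topology \<Rightarrow> bool" where
  "pi_uniform P T \<longleftrightarrow>
     group_topology (homeo_group\<lparr>carrier := P\<rparr>) T \<and> Hausdorff_space T \<and>
     (\<forall>g\<^sub>0\<in>P. \<forall>E. eventually E uniformity \<longrightarrow>
        (\<exists>D U. eventually D uniformity \<and> openin T U \<and> g\<^sub>0 \<in> U \<and>
           (\<forall>g\<in>U. \<forall>x y. D (x, y) \<longrightarrow> E (g x, g y))))"

definition strictly_coarser :: "'b topology \<Rightarrow> 'b topology \<Rightarrow> bool" where
  "strictly_coarser S T \<longleftrightarrow>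
     topspace S = topspace T \<and> (\<forall>U. openin S U \<longrightarrow> openin T U) \<and> S \<noteq> T"

definition minimal_topology_in :: "'b topology set \<Rightarrow> 'b topology \<Rightarrow> bool" where
  "minimal_topology_in C T \<longleftrightarrow> T \<in> C \<and> \<not> (\<exists>S\<in>C. strictly_coarser S T)"

end

theory Submission
  imports Defs
begin

text \<open>
  Let \<open>S\<close> be a \<open>\<pi>\<close>-uniform topology on \<open>P\<close> that is coarser than the compact-open topology, and
  suppose that elements \<open>g\<close> of \<open>P\<close> tend to \<open>g\<^sub>0\<close> along some filter in the sense of \<open>S\<close>. Inversion is
  \<open>S\<close>-continuous, so the inverses tend to the inverse of \<open>g\<^sub>0\<close>, and \<open>\<pi>\<close>-uniformity makes both the \<open>g\<close>
  and their inverses eventually equicontinuous. By Tychonoff's theorem the filter can be refined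
  so that \<open>g\<close> tends pointwise to a map \<open>f\<close> and the inverse of \<open>g\<close> to a map \<open>h\<close>; equicontinuity
  turns both into uniform convergence. Composition respects uniform convergence, hence \<open>f\<close> and
  \<open>h\<close> are mutually inverse homeomorphisms. They preserve the order because its graph is closed,
  and \<open>f\<close> lies in \<open>P\<close> because \<open>P\<close> is closed
  (\<open>pi_uniform_limit_in_closed_subgroup\<close>). Thus \<open>g\<close> converges to \<open>f\<close> in the compact-open
  topology, a fortiori in the coarser topology \<open>S\<close>, and as \<open>S\<close> is Hausdorff, \<open>f = g\<^sub>0\<close>. Every filter
  that converges in \<open>S\<close> therefore has a refinement that converges to the same point in the
  compact-open topology, so the two topologies agree.

  Uniform convergence enters in the form of continuous convergence: \<open>\<phi> i y\<close> tends to \<open>f x\<close> as \<open>i\<close>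
  runs along the filter and \<open>y\<close> tends to \<open>x\<close> simultaneously. On a compact Hausdorff space,
  for a continuous \<open>f\<close>, this is exactly convergence in the compact-open topology
  (\<open>limitin_compact_open_if_converges_continuously\<close> and
  \<open>converges_continuously_if_limitin_compact_open\<close>), it follows from pointwise convergence and
  equicontinuity (\<open>converges_continuously_if_equicontinuous\<close>), and it passes to compositions
  without any estimates. The same notion shows that the compact-open topology is itself a
  \<open>\<pi>\<close>-uniform group topology (\<open>pi_uniform_compact_open\<close>).
\<close>

(* From here on, inv is the inverse of a function; inversion in a group is written m_inv. *)
unbundle no m_inv_syntax

section \<open>Continuous convergence and the compact-open topology\<close>

text \<open>
  The classical notion of continuous convergence. It is joint in the index and the argument, so
  limits along moving arguments and of compositions become instances of composing limits.
\<close>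
definition converges_continuously ::
    "('i \<Rightarrow> 'a::topological_space \<Rightarrow> 'b::topological_space) \<Rightarrow> ('a \<Rightarrow> 'b) \<Rightarrow> 'i filter \<Rightarrow> bool" where
  "converges_continuously \<phi> f F \<longleftrightarrow> (\<forall>x. ((\<lambda>(i, y). \<phi> i y) \<longlongrightarrow> f x) (F \<times>\<^sub>F nhds x))"

lemma converges_continuously_compose:
  fixes \<phi> :: "'i \<Rightarrow> 'b::topological_space \<Rightarrow> 'c::topological_space"
    and \<psi> :: "'i \<Rightarrow> 'a::topological_space \<Rightarrow> 'b"
  assumes "converges_continuously \<phi> f F" and "converges_continuously \<psi> g F"
  shows "converges_continuously (\<lambda>i. \<phi> i \<circ> \<psi> i) (f \<circ> g) F"
  unfolding converges_continuously_def
proof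
  fix x :: 'a
  have "LIM p F \<times>\<^sub>F nhds x. fst p :> F"
    by (simp add: filterlim_def filtermap_fst_prod_filter)
  moreover have "LIM p F \<times>\<^sub>F nhds x. \<psi> (fst p) (snd p) :> nhds (g x)"
    using assms(2) by (simp add: converges_continuously_def case_prod_beta')
  ultimately have "LIM p F \<times>\<^sub>F nhds x. (fst p, \<psi> (fst p) (snd p)) :> F \<times>\<^sub>F nhds (g x)"
    by (rule filterlim_Pair)
  moreover have "((\<lambda>(i, y). \<phi> i y) \<longlongrightarrow> f (g x)) (F \<times>\<^sub>F nhds (g x))"
    using assms(1) by (simp add: converges_continuously_def)
  ultimately show "((\<lambda>(i, y). (\<phi> i \<circ> \<psi> i) y) \<longlongrightarrow> (f \<circ> g) x) (F \<times>\<^sub>F nhds x)"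
    by (auto dest: filterlim_compose simp: case_prod_beta')
qed

lemma converges_continuously_at:
  assumes "converges_continuously \<phi> f F" and "(y \<longlongrightarrow> x) F"
  shows "((\<lambda>i. \<phi> i (y i)) \<longlongrightarrow> f x) F"
proof -
  have "LIM i F. (i, y i) :> F \<times>\<^sub>F nhds x"
    using assms(2) by (intro filterlim_Pair) (auto simp: filterlim_ident)
  with assms(1) show ?thesis
    unfolding converges_continuously_def by (auto dest: filterlim_compose)
qed

lemma converges_continuously_nhdE:
  assumes "converges_continuously \<phi> f F" and "open V" and "f x \<in> V"
  obtains Q N where "eventually Q F" and "open N" and "x \<in> N"
    and "\<And>i y. Q i \<Longrightarrow> y \<in> N \<Longrightarrow> \<phi> i y \<in> V"
proof -
  have "eventually (\<lambda>(i, y). \<phi> i y \<in> V) (F \<times>\<^sub>F nhds x)"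
    using assms by (auto simp: converges_continuously_def case_prod_beta' dest: topological_tendstoD)
  then obtain Q R where "eventually Q F" "eventually R (nhds x)" "\<And>i y. Q i \<Longrightarrow> R y \<Longrightarrow> \<phi> i y \<in> V"
    by (auto simp: eventually_prod_filter)
  then show thesis
    using that by (metis eventually_nhds)
qed

lemma compact_t2_regular:
  fixes x :: "'a::t2_space"
  assumes "compact (UNIV :: 'a set)" and "open V" and "x \<in> V"
  obtains U where "open U" and "x \<in> U" and "closure U \<subseteq> V"
proof -
  have "compact_space (euclidean :: 'a topology)"
    using assms(1) by (simp add: compact_space_def)
  moreover have "Hausdorff_space (euclidean :: 'a topology)"
    unfolding Hausdorff_space_def disjnt_def by (simp, metis hausdorff)
  ultimately have "regular_space (euclidean :: 'a topology)"
    by (rule compact_Hausdorff_imp_regular_space)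
  then have "\<exists>U. open U \<and> x \<in> U \<and> disjnt (- V) (closure U)"
    using assms(2,3) by (auto simp: regular_space closed_Compl)
  then show thesis
    using that by (auto simp: disjnt_def)
qed

text \<open>
  If \<open>\<phi> i\<close> maps a whole neighbourhood of \<open>x\<close> into a small neighbourhood of \<open>f x\<close> for all large \<open>i\<close>,
  then its pointwise limit \<open>f\<close> maps that neighbourhood into the closure. Regularity of the
  target makes the closure as small as desired.
\<close>
lemma continuous_limit_of_continuous_convergence:
  fixes f :: "'a::topological_space \<Rightarrow> 'b::t2_space"
  assumes "compact (UNIV :: 'b set)"
    and "converges_continuously \<phi> f F" and "F \<noteq> bot"
  shows "continuous_on UNIV f"
proof -
  have "eventually (\<lambda>y. f y \<in> V) (nhds x)" if V: "open V" "f x \<in> V" for x V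
  proof -
    obtain U where U: "open U" "f x \<in> U" "closure U \<subseteq> V"
      using compact_t2_regular[OF assms(1) V] .
    obtain Q N where QN: "eventually Q F" "open N" "x \<in> N" "\<And>i y. Q i \<Longrightarrow> y \<in> N \<Longrightarrow> \<phi> i y \<in> U"
      using converges_continuously_nhdE[OF assms(2) U(1,2)] by metis
    have "f y \<in> closure U" if "y \<in> N" for y
    proof (rule Lim_in_closed_set)
      show "eventually (\<lambda>i. \<phi> i y \<in> closure U) F"
        using QN(1) by eventually_elim (use QN(4) that closure_subset in blast)
      show "((\<lambda>i. \<phi> i y) \<longlongrightarrow> f y) F"
        using converges_continuously_at[OF assms(2) tendsto_const] .
    qed (use assms(3) in auto)
    with QN(2,3) U(3) show ?thesis
      by (auto simp: eventually_nhds)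
  qed
  then have "(f \<longlongrightarrow> f x) (at x)" for x
    unfolding tendsto_at_iff_tendsto_nhds by (intro topological_tendstoI)
  then show ?thesis
    by (simp add: continuous_on_def)
qed

lemma topspace_compact_open [simp]: "topspace (compact_open_topology P) = P"
proof -
  have "P \<in> {{f \<in> P. f ` K \<subseteq> V} |K V. compact K \<and> open V}"
    \<comment> \<open>The condition imposed by the empty compact set is void.\<close>
    by (intro CollectI exI[of _ "{}"]) auto
  then show ?thesis
    unfolding compact_open_topology_def topology_generated_by_topspace by blast
qed

lemma openin_compact_open_subbasic:
  "compact K \<Longrightarrow> open V \<Longrightarrow> openin (compact_open_topology P) {f \<in> P. f ` K \<subseteq> V}"
  unfolding compact_open_topology_def by (rule topology_generated_by_Basis) blast

lemma limitin_topology_generated_by: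
  assumes "l \<in> \<Union>\<B>"
    and "\<And>B. B \<in> \<B> \<Longrightarrow> l \<in> B \<Longrightarrow> eventually (\<lambda>i. \<phi> i \<in> B) F"
  shows "limitin (topology_generated_by \<B>) \<phi> l F"
proof -
  have "l \<in> U \<longrightarrow> eventually (\<lambda>i. \<phi> i \<in> U) F" if "generate_topology_on \<B> U" for U
    using that
  proof induction
    case (UN K)
    then show ?case by (blast intro: eventually_mono)
  qed (use assms(2) in \<open>auto simp: eventually_conj_iff\<close>)
  then show ?thesis
    using assms(1) by (simp add: limitin_def openin_topology_generated_by_iff)
qed

text \<open>
  A compact \<open>K\<close> with \<open>f ` K \<subseteq> V\<close> is covered by finitely many of the neighbourhoods on which
  continuous convergence eventually forces values in \<open>V\<close>; finitely many eventual conditions on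
  \<open>i\<close> then put \<open>\<phi> i ` K\<close> inside \<open>V\<close>.
\<close>
lemma limitin_compact_open_if_converges_continuously:
  assumes "converges_continuously \<phi> f F"
    and "eventually (\<lambda>i. \<phi> i \<in> P) F" and "f \<in> P"
  shows "limitin (compact_open_topology P) \<phi> f F"
  unfolding compact_open_topology_def
proof (rule limitin_topology_generated_by)
  show "f \<in> \<Union>{{f \<in> P. f ` K \<subseteq> V} |K V. compact K \<and> open V}"
    using topspace_compact_open[of P] assms(3)
    unfolding compact_open_topology_def topology_generated_by_topspace by simp
next
  fix B assume "B \<in> {{f \<in> P. f ` K \<subseteq> V} |K V. compact K \<and> open V}" and "f \<in> B"
  then obtain K V where B: "B = {f \<in> P. f ` K \<subseteq> V}" and "compact K" "open V" "f ` K \<subseteq> V"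
    by blast
  have "\<exists>Q N. eventually Q F \<and> open N \<and> x \<in> N \<and> (\<forall>i y. Q i \<longrightarrow> y \<in> N \<longrightarrow> \<phi> i y \<in> V)"
    if "x \<in> K" for x
    using converges_continuously_nhdE[OF assms(1) \<open>open V\<close>, of x] \<open>f ` K \<subseteq> V\<close> that
    by (metis image_subset_iff)
  then obtain Q N where QN: "\<And>x. x \<in> K \<Longrightarrow> eventually (Q x) F" "\<And>x. x \<in> K \<Longrightarrow> open (N x)"
    "\<And>x. x \<in> K \<Longrightarrow> x \<in> N x"
    "\<And>x i y. x \<in> K \<Longrightarrow> Q x i \<Longrightarrow> y \<in> N x \<Longrightarrow> \<phi> i y \<in> V"
    by metis
  obtain C where C: "C \<subseteq> K" "finite C" "K \<subseteq> (\<Union>x\<in>C. N x)"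
    using compactE_image[OF \<open>compact K\<close>, of K N] QN(2,3) by blast
  have "eventually (\<lambda>i. \<forall>x\<in>C. Q x i) F"
    using C QN(1) by (intro eventually_ball_finite) auto
  with assms(2) show "eventually (\<lambda>i. \<phi> i \<in> B) F"
    by eventually_elim (use B C QN(4) in blast)
qed

text \<open>
  Given an open \<open>V\<close> around \<open>f x\<close>, the point \<open>x\<close> has a compact neighbourhood that the continuous map
  \<open>f\<close> sends into \<open>V\<close>; sending that neighbourhood into \<open>V\<close> is a subbasic condition, which \<open>\<phi> i\<close>
  eventually satisfies.
\<close>
lemma converges_continuously_if_limitin_compact_open:
  fixes f :: "'a::t2_space \<Rightarrow> 'a"
  assumes "compact (UNIV :: 'a set)" and "continuous_on UNIV f"
    and "limitin (compact_open_topology P) \<phi> f F"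
  shows "converges_continuously \<phi> f F"
  unfolding converges_continuously_def
proof (intro allI topological_tendstoI)
  fix x V assume V: "open V" "f x \<in> V"
  have "open (f -` V)"
    using assms(2) V(1) by (simp add: open_vimage)
  then obtain U where U: "open U" "x \<in> U" "closure U \<subseteq> f -` V"
    using compact_t2_regular[OF assms(1), of "f -` V" x] V(2) by auto
  have "compact (closure U)"
    using compact_Int_closed[OF assms(1), of "closure U"] by simp
  then have "openin (compact_open_topology P) {g \<in> P. g ` closure U \<subseteq> V}"
    using V(1) by (rule openin_compact_open_subbasic)
  moreover have "f \<in> {g \<in> P. g ` closure U \<subseteq> V}"
    using U(3) limitin_topspace[OF assms(3)] by auto
  ultimately have "eventually (\<lambda>i. \<phi> i \<in> {g \<in> P. g ` closure U \<subseteq> V}) F"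
    using assms(3) by (auto simp: limitin_def)
  moreover have "eventually (\<lambda>y. y \<in> U) (nhds x)"
    using U by (auto simp: eventually_nhds)
  ultimately have "eventually (\<lambda>p. \<phi> (fst p) \<in> {g \<in> P. g ` closure U \<subseteq> V} \<and> snd p \<in> U) (F \<times>\<^sub>F nhds x)"
    unfolding eventually_prod_filter by force
  then show "eventually (\<lambda>p. (case p of (i, y) \<Rightarrow> \<phi> i y) \<in> V) (F \<times>\<^sub>F nhds x)"
    by eventually_elim (use closure_subset[of U] in \<open>auto simp: image_subset_iff\<close>)
qed

section \<open>Equicontinuity\<close>

text \<open>
  The value \<open>\<phi> i y\<close> is close to \<open>\<phi> i x\<close> by equicontinuity, and \<open>\<phi> i x\<close> to \<open>f x\<close> by pointwise
  convergence. The set of indices on which equicontinuity holds may depend on the entourage \<open>E\<close>,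
  as does the neighbourhood of \<open>g\<^sub>0\<close> in the definition of \<open>\<pi>\<close>-uniformity.
\<close>
lemma converges_continuously_if_equicontinuous:
  fixes f :: "'a::uniform_space \<Rightarrow> 'b::uniform_space"
  assumes equi: "\<And>E. eventually E uniformity \<Longrightarrow>
      \<exists>D. eventually D uniformity \<and> eventually (\<lambda>i. \<forall>x y. D (x, y) \<longrightarrow> E (\<phi> i x, \<phi> i y)) F"
    and lim: "\<And>x. ((\<lambda>i. \<phi> i x) \<longlongrightarrow> f x) F"
  shows "converges_continuously \<phi> f F"
  unfolding converges_continuously_def
proof (intro allI topological_tendstoI)
  fix x V assume V: "open V" "f x \<in> V"
  then have "eventually (\<lambda>(a, b). a = f x \<longrightarrow> b \<in> V) uniformity"
    by (simp add: open_uniformity)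
  then obtain E where E: "eventually E uniformity" "\<And>b c. E (f x, b) \<Longrightarrow> E (b, c) \<Longrightarrow> c \<in> V"
    by (rule uniformity_transE) auto
  obtain D where D: "eventually D uniformity"
    "eventually (\<lambda>i. \<forall>x y. D (x, y) \<longrightarrow> E (\<phi> i x, \<phi> i y)) F"
    using equi[OF E(1)] by blast
  have "eventually (\<lambda>b. E (f x, b)) (nhds (f x))"
    using E(1) unfolding eventually_nhds_uniformity by eventually_elim auto
  then have "eventually (\<lambda>i. E (f x, \<phi> i x)) F"
    using lim[of x] unfolding filterlim_iff by blast
  with D(2) have "eventually (\<lambda>i. \<forall>y. D (x, y) \<longrightarrow> \<phi> i y \<in> V) F"
    by eventually_elim (use E(2) in blast)
  moreover have "eventually (\<lambda>y. D (x, y)) (nhds x)"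
    using D(1) unfolding eventually_nhds_uniformity by eventually_elim auto
  ultimately show "eventually (\<lambda>p. (case p of (i, y) \<Rightarrow> \<phi> i y) \<in> V) (F \<times>\<^sub>F nhds x)"
    unfolding eventually_prod_filter by (auto intro!: exI)
qed

text \<open>
  Near each point \<open>x\<close>, continuous convergence keeps the values of \<open>\<phi> i\<close> close to \<open>f x\<close>, hence
  close to each other. A Lebesgue-number argument makes this uniform in \<open>x\<close>: finitely many
  points \<open>x\<close> suffice, and two sufficiently close points both lie near one of them.
\<close>
lemma equicontinuous_if_converges_continuously:
  fixes f :: "'a::uniform_space \<Rightarrow> 'b::uniform_space"
  assumes "compact (UNIV :: 'a set)"
    and conv: "converges_continuously \<phi> f F" and E: "eventually E uniformity"
  shows "\<exists>D. eventually D uniformity \<and> eventually (\<lambda>i. \<forall>x y. D (x, y) \<longrightarrow> E (\<phi> i x, \<phi> i y)) F"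
proof -
  obtain E' where E': "eventually E' uniformity" "\<And>a b c. E' (a, b) \<Longrightarrow> E' (b, c) \<Longrightarrow> E (a, c)"
    using uniformity_transE[OF E] by metis
  have "\<exists>Q D. eventually Q F \<and> eventually D uniformity \<and>
      (\<forall>i y z. Q i \<longrightarrow> D (x, y) \<longrightarrow> D (y, z) \<longrightarrow> E (\<phi> i y, \<phi> i z))" for x
  proof -
    have "eventually (\<lambda>b. E' (f x, b) \<and> E' (b, f x)) (nhds (f x))"
      using E'(1) uniformity_sym[OF E'(1)] unfolding eventually_nhds_uniformity
      by eventually_elim auto
    then obtain V where V: "open V" "f x \<in> V" "\<And>b. b \<in> V \<Longrightarrow> E' (f x, b) \<and> E' (b, f x)"
      by (auto simp: eventually_nhds)
    obtain Q N where QN: "eventually Q F" "open N" "x \<in> N" "\<And>i y. Q i \<Longrightarrow> y \<in> N \<Longrightarrow> \<phi> i y \<in> V"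
      using converges_continuously_nhdE[OF conv V(1,2)] by metis
    \<comment> \<open>Halving the entourage leaves room for a second step: everything \<open>D\<close>-close to a point
      that is \<open>D\<close>-close to \<open>x\<close> is still in \<open>N\<close>.\<close>
    have "eventually (\<lambda>(a, b). a = x \<longrightarrow> b \<in> N) uniformity"
      using QN(2,3) by (simp add: open_uniformity)
    then obtain D where D: "eventually D uniformity" "\<And>y z. D (x, y) \<Longrightarrow> D (y, z) \<Longrightarrow> z \<in> N"
      by (rule uniformity_transE) auto
    have "E (\<phi> i y, \<phi> i z)" if "Q i" "D (x, y)" "D (y, z)" for i y z
    proof -
      have "y \<in> N" "z \<in> N"
        using D(2) that uniformity_refl[OF D(1)] by blast+
      then show ?thesis
        using QN(4) V(3) E'(2) that(1) by blast
    qed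
    then show ?thesis
      using QN(1) D(1) by blast
  qed
  then obtain Q D where QD: "\<And>x. eventually (Q x) F" "\<And>x. eventually (D x) uniformity"
    "\<And>x i y z. Q x i \<Longrightarrow> D x (x, y) \<Longrightarrow> D x (y, z) \<Longrightarrow> E (\<phi> i y, \<phi> i z)"
    by metis
  have "\<exists>N. open N \<and> x \<in> N \<and> (\<forall>y\<in>N. D x (x, y))" for x
  proof -
    have "eventually (\<lambda>y. D x (x, y)) (nhds x)"
      using QD(2)[of x] unfolding eventually_nhds_uniformity by eventually_elim auto
    then show ?thesis
      by (simp add: eventually_nhds)
  qed
  then obtain N where N: "\<And>x. open (N x)" "\<And>x. x \<in> N x" "\<And>x y. y \<in> N x \<Longrightarrow> D x (x, y)"
    by metis
  obtain C where C: "C \<subseteq> UNIV" "finite C" "UNIV \<subseteq> (\<Union>x\<in>C. N x)"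
  proof (rule compactE_image[OF assms(1)])
    show "UNIV \<subseteq> (\<Union>x\<in>UNIV. N x)"
      using N(2) by blast
  qed (use N(1) in auto)
  have D: "eventually (\<lambda>p. \<forall>x\<in>C. D x p) uniformity" and Q: "eventually (\<lambda>i. \<forall>x\<in>C. Q x i) F"
    using C(2) QD(1,2) by (simp_all add: eventually_ball_finite)
  have "E (\<phi> i y, \<phi> i z)" if "\<forall>x\<in>C. Q x i" "\<forall>x\<in>C. D x (y, z)" for i y z
  proof -
    obtain x where "x \<in> C" "y \<in> N x"
      using C(3) by blast
    with that show ?thesis
      using QD(3) N(3) by blast
  qed
  then have "eventually (\<lambda>i. \<forall>y z. (\<forall>x\<in>C. D x (y, z)) \<longrightarrow> E (\<phi> i y, \<phi> i z)) F"
    using Q by (auto elim: eventually_mono)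
  with D show ?thesis
    by (intro exI[of _ "\<lambda>p. \<forall>x\<in>C. D x p"] conjI)
qed

text \<open>
  The product topology on all functions is compact by Tychonoff's theorem, so the image of \<open>F\<close>
  has a cluster point \<open>f\<close>. Adding the preimages of the neighbourhoods of \<open>f\<close> to \<open>F\<close> gives \<open>G\<close>.
\<close>
lemma pointwise_convergent_refinement:
  fixes \<phi> :: "'i \<Rightarrow> 'a \<Rightarrow> 'b::topological_space"
  assumes "compact (UNIV :: 'b set)" and "F \<noteq> bot"
  obtains f G where "G \<le> F" and "G \<noteq> bot" and "\<And>x. ((\<lambda>i. \<phi> i x) \<longlongrightarrow> f x) G"
proof -
  have "compact_space (euclidean :: 'b topology)"
    using assms(1) by (simp add: compact_space_def)
  then have "compact_space (product_topology (\<lambda>_ :: 'a. euclidean :: 'b topology) UNIV)"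
    by (simp add: compact_space_product_topology)
  then have "compact (UNIV :: ('a \<Rightarrow> 'b) set)"
    by (simp add: euclidean_product_topology compact_space_def)
  moreover have "filtermap \<phi> F \<noteq> bot"
    using assms(2) by (simp add: filtermap_bot_iff)
  ultimately obtain f where f: "inf (nhds f) (filtermap \<phi> F) \<noteq> bot"
    unfolding compact_filter by auto
  define G where "G = inf (filtercomap \<phi> (nhds f)) F"
  have "G \<noteq> bot"
  proof
    assume "G = bot"
    then have "eventually (\<lambda>_. False) G"
      by simp
    then obtain Q R where QR: "eventually Q (filtercomap \<phi> (nhds f))" "eventually R F" "\<And>i. \<not> (Q i \<and> R i)"
      unfolding G_def eventually_inf by blast
    then obtain Q' where Q': "eventually Q' (nhds f)" "\<And>i. Q' (\<phi> i) \<Longrightarrow> Q i"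
      by (auto simp: eventually_filtercomap)
    have "eventually (\<lambda>h. \<exists>i. h = \<phi> i \<and> R i) (filtermap \<phi> F)"
      using QR(2) by (auto simp: eventually_filtermap elim: eventually_mono)
    with Q'(1) have "eventually (\<lambda>_. False) (inf (nhds f) (filtermap \<phi> F))"
      unfolding eventually_inf using Q'(2) QR(3) by blast
    with f show False
      by (simp add: trivial_limit_def)
  qed
  moreover have "((\<lambda>i. \<phi> i x) \<longlongrightarrow> f x) G" for x
  proof -
    have "filterlim \<phi> (nhds f) G"
      unfolding filterlim_iff_le_filtercomap G_def by (rule inf_le1)
    moreover have "((\<lambda>h. h x) \<longlongrightarrow> f x) (nhds f)"
      using continuous_on_product_coordinates[of x, where ?'b = 'b]
        tendsto_at_iff_tendsto_nhds[of "\<lambda>h. h x" f]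
      by (simp add: continuous_on_def)
    ultimately show ?thesis
      by (rule filterlim_compose[rotated])
  qed
  moreover have "G \<le> F"
    by (simp add: G_def)
  ultimately show thesis
    using that by blast
qed

section \<open>Groups of order automorphisms\<close>

lemma homeomorphic_map_euclidean_iff:
  "homeomorphic_map euclidean euclidean f \<longleftrightarrow>
     bij f \<and> continuous_on UNIV f \<and> continuous_on UNIV (inv f)"
proof
  assume f: "homeomorphic_map euclidean euclidean f"
  then obtain g where "homeomorphic_maps euclidean euclidean f g"
    by (auto simp: homeomorphic_map_maps)
  then have g: "continuous_on UNIV f" "continuous_on UNIV g" "\<And>x. g (f x) = x" "\<And>x. f (g x) = x"
    by (auto simp: homeomorphic_maps_def)
  then have "g \<circ> f = id" "f \<circ> g = id"
    by (auto simp: fun_eq_iff)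
  then have "inv f = g" "bij f"
    by (auto intro: inv_unique_comp o_bij)
  with g show "bij f \<and> continuous_on UNIV f \<and> continuous_on UNIV (inv f)"
    by simp
next
  assume "bij f \<and> continuous_on UNIV f \<and> continuous_on UNIV (inv f)"
  then have "homeomorphic_maps euclidean euclidean f (inv f)"
    by (auto simp: homeomorphic_maps_def bij_is_inj bij_is_surj surj_f_inv_f)
  then show "homeomorphic_map euclidean euclidean f"
    by (auto simp: homeomorphic_map_maps)
qed

lemma mem_homeo_plus_group_iff:
  "f \<in> carrier homeo_plus_group \<longleftrightarrow>
     bij f \<and> continuous_on UNIV f \<and> continuous_on UNIV (inv f) \<and> (\<forall>x y. x \<le> y \<longleftrightarrow> f x \<le> f y)"
  by (simp add: homeo_plus_group_def homeo_group_def homeomorphic_map_euclidean_iff)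

lemma mult_homeo_plus_group [simp]: "x \<otimes>\<^bsub>homeo_plus_group\<^esub> y = x \<circ> y"
  by (simp add: homeo_plus_group_def homeo_group_def)

lemma inv_mem_homeo_plus_group:
  assumes "f \<in> carrier homeo_plus_group"
  shows "inv f \<in> carrier homeo_plus_group"
  using assms unfolding mem_homeo_plus_group_iff
  by (metis bij_imp_bij_inv bij_inv_eq_iff inv_inv_eq)

lemma m_inv_eq_inv_if_mult_comp:
  assumes "inv f \<in> carrier G" and "bij f" and "mult G = (\<circ>)" and "one G = id"
  shows "m_inv G f = inv f"
  unfolding m_inv_def assms(3,4)
proof (rule the_equality)
  show "inv f \<in> carrier G \<and> f \<circ> inv f = id \<and> inv f \<circ> f = id"
    using assms by (auto simp: bij_is_inj surj_iff[symmetric] bij_is_surj)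
next
  fix g assume "g \<in> carrier G \<and> f \<circ> g = id \<and> g \<circ> f = id"
  then show "g = inv f"
    by (metis inv_unique_comp)
qed

lemma subgroup_homeo_plus_groupD:
  assumes "subgroup P homeo_plus_group" and "f \<in> P"
  shows "f \<in> carrier homeo_plus_group" and "inv f \<in> P"
    and "m_inv (homeo_group\<lparr>carrier := P\<rparr>) f = inv f"
proof -
  show f: "f \<in> carrier homeo_plus_group"
    using assms subgroup.subset by blast
  then have bij: "bij f"
    by (simp add: mem_homeo_plus_group_iff)
  have "m_inv homeo_plus_group f = inv f"
    using inv_mem_homeo_plus_group[OF f] bij
    by (intro m_inv_eq_inv_if_mult_comp) (auto simp: homeo_plus_group_def homeo_group_def)
  then show "inv f \<in> P"
    using subgroup.m_inv_closed[OF assms] by simp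
  with bij show "m_inv (homeo_group\<lparr>carrier := P\<rparr>) f = inv f"
    by (intro m_inv_eq_inv_if_mult_comp) (auto simp: homeo_group_def)
qed

section \<open>The compact-open topology is \<open>\<pi>\<close>-uniform\<close>

text \<open>
  Composition is continuous because continuous convergence passes to compositions. Inversion is
  continuous because it permutes the subbasic conditions: for a bijection \<open>f\<close>, the inverse maps
  \<open>K\<close> into \<open>V\<close> iff \<open>f\<close> maps the complement of \<open>V\<close>, which is compact, into that of \<open>K\<close>, which is
  open.
\<close>
lemma group_topology_compact_open:
  fixes P :: "('a::{t2_space,order} \<Rightarrow> 'a) set"
  assumes comp: "compact (UNIV :: 'a set)" and P: "subgroup P homeo_plus_group"
  shows "group_topology (homeo_group\<lparr>carrier := P\<rparr>) (compact_open_topology P)" (is "group_topology ?G ?T")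
proof -
  note PD = subgroup_homeo_plus_groupD[OF P]
  have "continuous_map (prod_topology ?T ?T) ?T (\<lambda>(f, g). f \<circ> g)"
    unfolding continuous_map_atin
  proof
    fix p assume p: "p \<in> topspace (prod_topology ?T ?T)"
    obtain f g where fg: "p = (f, g)" "f \<in> P" "g \<in> P"
      using p by auto
    let ?F = "atin (prod_topology ?T ?T) p"
    have lim: "limitin ?T fst f ?F" "limitin ?T snd g ?F"
      using limitin_continuous_map[OF continuous_map_fst p] limitin_continuous_map[OF continuous_map_snd p] fg
      by simp_all
    have "converges_continuously fst f ?F" "converges_continuously snd g ?F"
      using converges_continuously_if_limitin_compact_open[OF comp _ lim(1)]
        converges_continuously_if_limitin_compact_open[OF comp _ lim(2)] PD(1) fg
      by (auto simp: mem_homeo_plus_group_iff)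
    then have "converges_continuously (\<lambda>q. fst q \<circ> snd q) (f \<circ> g) ?F"
      by (rule converges_continuously_compose)
    moreover have mem: "h \<circ> k \<in> P" if "h \<in> P" "k \<in> P" for h k
      using subgroup.m_closed[OF P that] by simp
    moreover have "eventually (\<lambda>q. fst q \<circ> snd q \<in> P) ?F"
    proof -
      have "eventually (\<lambda>q. fst q \<in> P) ?F" "eventually (\<lambda>q. snd q \<in> P) ?F"
        using lim fg openin_topspace[of ?T] by (auto simp: limitin_def)
      then show ?thesis
        by eventually_elim (rule mem)
    qed
    ultimately have "limitin ?T (\<lambda>q. fst q \<circ> snd q) (f \<circ> g) ?F"
      using fg by (intro limitin_compact_open_if_converges_continuously)
    then show "limitin ?T (\<lambda>(f, g). f \<circ> g) (case p of (f, g) \<Rightarrow> f \<circ> g) ?F"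
      by (simp add: fg case_prod_beta')
  qed
  moreover have "continuous_map ?T ?T inv"
    unfolding compact_open_topology_def[of P]
  proof (subst continuous_on_generated_topo_iff, fold compact_open_topology_def, intro conjI allI impI)
    fix B assume "B \<in> {{f \<in> P. f ` K \<subseteq> V} |K V. compact K \<and> open V}"
    then obtain K V where B: "B = {f \<in> P. f ` K \<subseteq> V}" "compact K" "open V"
      by blast
    have "inv f ` K \<subseteq> V \<longleftrightarrow> f ` (- V) \<subseteq> - K" if "f \<in> P" for f
    proof -
      have f: "bij f"
        using PD(1)[OF that] by (simp add: mem_homeo_plus_group_iff)
      then have "inv f ` K = f -` K"
        by (simp add: bij_vimage_eq_inv_image)
      then show ?thesis
        by auto
    qed
    then have "inv -` B \<inter> P = {f \<in> P. f ` (- V) \<subseteq> - K}"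
      using B(1) PD(2) by auto
    moreover have "compact (- V)" "open (- K)"
      using B(2,3) compact_Int_closed[OF comp, of "- V"] by (auto simp: compact_imp_closed)
    ultimately show "openin ?T (inv -` B \<inter> topspace ?T)"
      using openin_compact_open_subbasic by simp
  next
    have "\<Union>{{f \<in> P. f ` K \<subseteq> V} |K V. compact K \<and> open V} = P"
      using topspace_compact_open[of P]
      unfolding compact_open_topology_def topology_generated_by_topspace .
    then show "inv ` topspace ?T \<subseteq> \<Union>{{f \<in> P. f ` K \<subseteq> V} |K V. compact K \<and> open V}"
      using PD(2) by auto
  qed
  then have "continuous_map ?T ?T (m_inv ?G)"
    by (rule continuous_map_eq) (simp add: PD(3))
  ultimately show ?thesis
    by (simp add: group_topology_def homeo_group_def)
qed

lemma Hausdorff_space_compact_open: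
  fixes P :: "('a::t2_space \<Rightarrow> 'a) set"
  shows "Hausdorff_space (compact_open_topology P)"
  unfolding Hausdorff_space_def
proof (intro allI impI)
  fix f g assume fg: "f \<in> topspace (compact_open_topology P) \<and> g \<in> topspace (compact_open_topology P) \<and> f \<noteq> g"
  then obtain x where "f x \<noteq> g x"
    by blast
  from hausdorff[OF this]
  obtain U V where UV: "open U" "open V" "f x \<in> U" "g x \<in> V" "U \<inter> V = {}"
    by blast
  have "openin (compact_open_topology P) {h \<in> P. h ` {x} \<subseteq> U}"
    "openin (compact_open_topology P) {h \<in> P. h ` {x} \<subseteq> V}"
    using UV by (auto intro!: openin_compact_open_subbasic simp del: image_insert)
  moreover have "f \<in> {h \<in> P. h ` {x} \<subseteq> U}" "g \<in> {h \<in> P. h ` {x} \<subseteq> V}"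
    "disjnt {h \<in> P. h ` {x} \<subseteq> U} {h \<in> P. h ` {x} \<subseteq> V}"
    using UV fg by (auto simp: disjnt_def)
  ultimately show "\<exists>U V. openin (compact_open_topology P) U \<and> openin (compact_open_topology P) V \<and>
      f \<in> U \<and> g \<in> V \<and> disjnt U V"
    by blast
qed

text \<open>
  The identity family, indexed by the neighbourhood filter of \<open>g\<^sub>0\<close>, converges continuously to
  \<open>g\<^sub>0\<close>, and equicontinuity along that filter is what \<open>\<pi>\<close>-uniformity demands.
\<close>
lemma pi_uniform_compact_open:
  fixes P :: "('a::{uniform_space,t2_space,order} \<Rightarrow> 'a) set"
  assumes comp: "compact (UNIV :: 'a set)" and P: "subgroup P homeo_plus_group"
  shows "pi_uniform P (compact_open_topology P)" (is "pi_uniform P ?T")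
proof -
  have "\<exists>D U. eventually D uniformity \<and> openin ?T U \<and> g\<^sub>0 \<in> U \<and>
      (\<forall>g\<in>U. \<forall>x y. D (x, y) \<longrightarrow> E (g x, g y))"
    if g: "g\<^sub>0 \<in> P" and E: "eventually E uniformity" for g\<^sub>0 E
  proof -
    have "limitin ?T (\<lambda>g. g) g\<^sub>0 (nhdsin ?T g\<^sub>0)"
      using g by (auto simp: limitin_def eventually_nhdsin)
    then have "converges_continuously (\<lambda>g. g) g\<^sub>0 (nhdsin ?T g\<^sub>0)"
      using converges_continuously_if_limitin_compact_open[OF comp]
        subgroup_homeo_plus_groupD(1)[OF P g] by (auto simp: mem_homeo_plus_group_iff)
    from equicontinuous_if_converges_continuously[OF comp this E]
    show ?thesis
      using g by (auto simp: eventually_nhdsin)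
  qed
  then show ?thesis
    unfolding pi_uniform_def
    using group_topology_compact_open[OF comp P] Hausdorff_space_compact_open by blast
qed

section \<open>Minimality\<close>

text \<open>
  This is the core of the argument: a filter that converges in a \<open>\<pi>\<close>-uniform topology has a
  cluster point in the compact-open topology. Passing to the limit for \<open>g\<close> and its inverse at the same
  time is essential, since a uniform limit of homeomorphisms alone need not be injective; the
  limit of the inverses supplies the inverse of the limit. The limit is not claimed to be
  \<open>g\<^sub>0\<close>, which requires a comparison between the two topologies.
\<close>
lemma pi_uniform_limit_in_closed_subgroup:
  fixes P :: "('a::{uniform_space,t2_space,order} \<Rightarrow> 'a) set"
  assumes comp: "compact (UNIV :: 'a set)" and ord: "closed_order TYPE('a)"
    and P: "subgroup P homeo_plus_group"
    and closed: "closedin (compact_open_topology (carrier homeo_plus_group)) P"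
    and S: "pi_uniform P S" and g: "g\<^sub>0 \<in> P" and F: "F \<le> nhdsin S g\<^sub>0" "F \<noteq> bot"
  obtains f G where "G \<le> F" and "G \<noteq> bot" and "limitin (compact_open_topology P) (\<lambda>g. g) f G"
proof -
  note PD = subgroup_homeo_plus_groupD[OF P]
  have top: "topspace S = P" and inv_cont: "continuous_map S S (m_inv (homeo_group\<lparr>carrier := P\<rparr>))"
    using S by (auto simp: pi_uniform_def group_topology_def)
  have inP_F: "eventually (\<lambda>g. g \<in> P) F"
    by (rule filter_leD[OF F(1)]) (use g top in \<open>auto simp: eventually_nhdsin\<close>)
  have equi: "\<exists>D. eventually D uniformity \<and> eventually (\<lambda>g. \<forall>x y. D (x, y) \<longrightarrow> E (g x, g y)) (nhdsin S h)"
    if "h \<in> P" "eventually E uniformity" for h E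
    using S that by (fastforce simp: pi_uniform_def eventually_nhdsin)
  \<comment> \<open>Equicontinuity at \<open>g\<^sub>0\<close> controls the maps \<open>g\<close>; equicontinuity at the inverse of \<open>g\<^sub>0\<close>,
    transported by continuity of inversion, controls the maps \<open>inv g\<close>.\<close>
  have equi1: "\<exists>D. eventually D uniformity \<and> eventually (\<lambda>g. \<forall>x y. D (x, y) \<longrightarrow> E (g x, g y)) F"
    if "eventually E uniformity" for E
    using equi[OF g that] F(1) by (auto simp: le_filter_def)
  have "limitin S inv (inv g\<^sub>0) F"
    unfolding limitin_def
  proof (intro conjI allI impI)
    fix U assume U: "openin S U \<and> inv g\<^sub>0 \<in> U"
    have "openin S {g \<in> P. m_inv (homeo_group\<lparr>carrier := P\<rparr>) g \<in> U}"
      using openin_continuous_map_preimage[OF inv_cont, of U] U top by simp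
    moreover have "{g \<in> P. m_inv (homeo_group\<lparr>carrier := P\<rparr>) g \<in> U} = {g \<in> P. inv g \<in> U}"
      using PD(3) by auto
    ultimately have "eventually (\<lambda>g. inv g \<in> U) (nhdsin S g\<^sub>0)"
      using g U by (auto simp: eventually_nhdsin)
    then show "eventually (\<lambda>g. inv g \<in> U) F"
      using F(1) by (simp add: le_filter_def)
  qed (use g PD(2) top in auto)
  then have "filterlim inv (nhdsin S (inv g\<^sub>0)) F"
    using PD(2)[OF g] top
    by (auto simp: limitin_def filterlim_iff eventually_nhdsin intro: eventually_mono)
  then have equi2: "\<exists>D. eventually D uniformity \<and> eventually (\<lambda>g. \<forall>x y. D (x, y) \<longrightarrow> E (inv g x, inv g y)) F"
    if "eventually E uniformity" for E
    using equi[OF PD(2)[OF g] that] by (auto simp: filterlim_iff)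
  obtain G1 f where G1: "G1 \<le> F" "G1 \<noteq> bot" "\<And>x. ((\<lambda>g. g x) \<longlongrightarrow> f x) G1"
    using pointwise_convergent_refinement[OF comp F(2), where \<phi> = "\<lambda>g. g"] by metis
  obtain G h where G: "G \<le> G1" "G \<noteq> bot" "\<And>x. ((\<lambda>g. inv g x) \<longlongrightarrow> h x) G"
    using pointwise_convergent_refinement[OF comp G1(2), where \<phi> = inv] by metis
  have GF: "G \<le> F"
    using G(1) G1(1) by simp
  have limf: "((\<lambda>g. g x) \<longlongrightarrow> f x) G" for x
    using G1(3) G(1) tendsto_mono by blast
  have convf: "converges_continuously (\<lambda>g. g) f G"
    using converges_continuously_if_equicontinuous[of "\<lambda>g. g" G f] equi1 limf GF
    by (meson filter_leD)
  have convh: "converges_continuously inv h G"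
    using converges_continuously_if_equicontinuous[of inv G h] equi2 G(3) GF
    by (meson filter_leD)
  have inP: "eventually (\<lambda>g. g \<in> P) G"
    using inP_F GF by (rule filter_leD[rotated])
  have inH: "eventually (\<lambda>g. g \<in> carrier homeo_plus_group) G"
    using inP by eventually_elim (rule PD(1))
  have fh: "f (h x) = x" for x
  proof (rule tendsto_unique[OF G(2)])
    show "((\<lambda>g. g (inv g x)) \<longlongrightarrow> f (h x)) G"
      using converges_continuously_at[OF convf G(3)] .
    have "eventually (\<lambda>g. x = g (inv g x)) G"
      using inH by eventually_elim (simp add: mem_homeo_plus_group_iff bij_is_surj surj_f_inv_f)
    then show "((\<lambda>g. g (inv g x)) \<longlongrightarrow> x) G"
      by (rule Lim_transform_eventually[OF tendsto_const])
  qed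
  have hf: "h (f x) = x" for x
  proof (rule tendsto_unique[OF G(2)])
    show "((\<lambda>g. inv g (g x)) \<longlongrightarrow> h (f x)) G"
      using converges_continuously_at[OF convh limf] .
    have "eventually (\<lambda>g. x = inv g (g x)) G"
      using inH by eventually_elim (simp add: mem_homeo_plus_group_iff bij_is_inj)
    then show "((\<lambda>g. inv g (g x)) \<longlongrightarrow> x) G"
      by (rule Lim_transform_eventually[OF tendsto_const])
  qed
  have bij: "bij f" and invf: "inv f = h"
  proof -
    have "h \<circ> f = id" "f \<circ> h = id"
      using fh hf by (auto simp: fun_eq_iff)
    then show "bij f" "inv f = h"
      by (auto intro: inv_unique_comp o_bij)
  qed
  \<comment> \<open>The order has a closed graph, so inequalities survive pointwise limits. Applied to both
    \<open>f\<close> and \<open>h\<close>, this yields the equivalence required of an order automorphism.\<close>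
  have le_limit: "u x \<le> u y"
    if "x \<le> y" "\<And>z. ((\<lambda>g. \<phi> g z) \<longlongrightarrow> u z) G"
      "eventually (\<lambda>g. \<phi> g x \<le> \<phi> g y) G" for u :: "'a \<Rightarrow> 'a" and \<phi> x y
  proof -
    have "(u x, u y) \<in> {(a, b). a \<le> b}"
    proof (rule Lim_in_closed_set)
      show "closed {(a :: 'a, b). a \<le> b}"
        using ord by (simp add: closed_order_def)
      show "((\<lambda>g. (\<phi> g x, \<phi> g y)) \<longlongrightarrow> (u x, u y)) G"
        using that(2) by (intro tendsto_Pair)
    qed (use that(3) G(2) in auto)
    then show ?thesis by simp
  qed
  have monof: "f x \<le> f y" if "x \<le> y" for x y
    by (rule le_limit[OF that limf])
      (use inH that in \<open>auto elim!: eventually_mono simp: mem_homeo_plus_group_iff\<close>)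
  have monoh: "h x \<le> h y" if "x \<le> y" for x y
  proof (rule le_limit[OF that G(3)])
    show "eventually (\<lambda>g. inv g x \<le> inv g y) G"
      using inH
    proof eventually_elim
      case (elim g)
      then show ?case
        using inv_mem_homeo_plus_group[OF elim] that by (auto simp: mem_homeo_plus_group_iff)
    qed
  qed
  have "f \<in> carrier homeo_plus_group"
    unfolding mem_homeo_plus_group_iff invf
    using bij monof monoh hf continuous_limit_of_continuous_convergence[OF comp convf G(2)]
      continuous_limit_of_continuous_convergence[OF comp convh G(2)] by metis
  then have lim: "limitin (compact_open_topology (carrier homeo_plus_group)) (\<lambda>g. g) f G"
    using limitin_compact_open_if_converges_continuously[OF convf inH] by simp
  have "f \<in> P"
    by (rule limitin_closedin[OF lim closed inP]) (use G(2) in simp)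
  then have "limitin (compact_open_topology P) (\<lambda>g. g) f G"
    using limitin_compact_open_if_converges_continuously[OF convf inP] by simp
  with GF G(2) show thesis
    using that by blast
qed

theorem theorem3p1:
  fixes P :: "('a::{uniform_space,t2_space,order} \<Rightarrow> 'a) set"
  assumes "compact (UNIV :: 'a set)"
    and "closed_order TYPE('a)"
    and "subgroup P homeo_plus_group"
    and "closedin (compact_open_topology (carrier homeo_plus_group)) P"
  shows "minimal_topology_in {T. pi_uniform P T} (compact_open_topology P)"
proof -
  have "S = compact_open_topology P"
    if S: "pi_uniform P S" and coarser: "\<And>U. openin S U \<Longrightarrow> openin (compact_open_topology P) U" for S
  proof -
    have top: "topspace S = P" and haus: "Hausdorff_space S"
      using S by (auto simp: pi_uniform_def group_topology_def homeo_group_def)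
    have "openin S U" if U: "openin (compact_open_topology P) U" for U
    proof (subst openin_subopen, intro ballI, rule ccontr)
      fix g\<^sub>0 assume g: "g\<^sub>0 \<in> U" and no: "\<not> (\<exists>T. openin S T \<and> g\<^sub>0 \<in> T \<and> T \<subseteq> U)"
      have gP: "g\<^sub>0 \<in> P"
        using g openin_subset[OF U] by auto
      \<comment> \<open>If no \<open>S\<close>-neighbourhood of \<open>g\<^sub>0\<close> fits into \<open>U\<close>, some filter tends to \<open>g\<^sub>0\<close> in \<open>S\<close> while
        staying outside \<open>U\<close>; a compact-open limit of a refinement contradicts this.\<close>
      define F where "F = inf (nhdsin S g\<^sub>0) (principal (- U))"
      have "F \<noteq> bot"
        using no gP top by (auto simp: F_def trivial_limit_def eventually_inf_principal eventually_nhdsin)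
      moreover have "F \<le> nhdsin S g\<^sub>0"
        by (simp add: F_def)
      ultimately obtain f G where G: "G \<le> F" "G \<noteq> bot"
        and lim: "limitin (compact_open_topology P) (\<lambda>g. g) f G"
        using pi_uniform_limit_in_closed_subgroup[OF assms S gP] by metis
      have "limitin S (\<lambda>g. g) f G"
        using lim coarser top by (auto simp: limitin_def)
      moreover have "limitin S (\<lambda>g. g) g\<^sub>0 G"
        unfolding limitin_def
      proof (intro conjI allI impI)
        fix W assume "openin S W \<and> g\<^sub>0 \<in> W"
        then have "eventually (\<lambda>g. g \<in> W) (nhdsin S g\<^sub>0)"
          by (auto simp: eventually_nhdsin)
        then show "eventually (\<lambda>g. g \<in> W) G"
          using G(1) \<open>F \<le> nhdsin S g\<^sub>0\<close> by (simp add: le_filter_def)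
      qed (use gP top in simp)
      ultimately have "f = g\<^sub>0"
        using limitin_Hausdorff_unique haus G(2) by metis
      with lim g U have "eventually (\<lambda>g. g \<in> U) G"
        by (simp add: limitin_def)
      moreover have "eventually (\<lambda>g. g \<notin> U) G"
        by (rule filter_leD[OF G(1)]) (simp add: F_def eventually_inf_principal)
      ultimately have "eventually (\<lambda>_. False) G"
        by eventually_elim simp
      with G(2) show False
        by (simp add: trivial_limit_def)
    qed
    with coarser show ?thesis
      by (auto simp: topology_eq)
  qed
  then show ?thesis
    using pi_uniform_compact_open[OF assms(1,3)]
    by (auto simp: minimal_topology_in_def strictly_coarser_def)
qed

end
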